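(* For the polynomials $p_1=Y$, $p_2=1-Y$, $p_3=1+X$, $p_4=Y-X^3$ in $\mathbb{R}[X,Y]$, the Lasserre relaxation $\mathscr{L}(\underline p)_1\subseteq\mathbb{R}^2$ has a non-exposed face at the point $(1/2,1/8)$ (i.e. $\{(1/2,1/8)\}$ is a non-exposed face of $\mathscr{L}(\underline p)_1$).
   Context: Let $\mathbb{R}[X,Y]_d$ be the space of real polynomials in $X,Y$ of degree at most $d$. For $\underline p=(p_1,\ldots,p_r)$ define $\mathrm{QM}(\underline p)_d=\{\sigma_0+\sigma_1p_1+\cdots+\sigma_rp_r\mid \sigma_i\in\sum(\mathbb{R}[X,Y]_d)^2\}$, where $\sum(\mathbb{R}[X,Y]_d)^2$ is the set of finite sums of squares of elements of $\mathbb{R}[X,Y]_d$. The degree $d$ Lasserre relaxation is $\mathscr{L}(\underline p)_d=\{z\in\mathbb{R}^2\mid \ell(z)\ge 0 \text{ for all } \ell\in \mathrm{QM}(\underline p)_d\cap\mathbb{R}[X,Y]_1\}$. A face of a convex set $S$ is a nonempty convex subset $F\subseteq S$ such that whenever $\lambda x+(1-\lambda)y\in F$ for some $x,y\in S$, $\lambda\in(0,1)$, then $x,y\in F$. A face is exposed if it is of the form $\{x\in S\mid \ell(x)=0\}$ for some affine linear polynomial $\ell$ that is nonnegative on $S$. *)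

theory Defs
  imports "HOL-Analysis.Analysis" "HOL-Computational_Algebra.Polynomial"
begin

text \<open>
  The ring \<open>\<real>[X,Y]\<close> is represented as \<open>(\<real>[X])[Y]\<close>, i.e. by the type \<open>real poly poly\<close>:
  the outer indeterminate is \<open>Y\<close>, the inner one is \<open>X\<close>, and the coefficient of
  \<open>X ^ i * Y ^ j\<close> in \<open>p\<close> is \<open>coeff (coeff p j) i\<close>.
\<close>

type_synonym bipoly = "real poly poly"

definition polyX :: bipoly where "polyX = [:[:0, 1:]:]"

definition polyY :: bipoly where "polyY = [:0, 1:]"

definition eval2 :: "bipoly \<Rightarrow> real \<times> real \<Rightarrow> real" where
  "eval2 p z = poly (poly p [:snd z:]) (fst z)"

text \<open>\<open>\<real>[X,Y]\<close> in total degree at most \<open>d\<close>; the library's \<open>degree\<close> is only the degree in \<open>Y\<close>.\<close>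

definition bipolys_upto :: "nat \<Rightarrow> bipoly set" where
  "bipolys_upto d = {p. \<forall>i j. coeff (coeff p j) i \<noteq> 0 \<longrightarrow> i + j \<le> d}"

text \<open>The degree bound is on the polynomials being squared, so sums of squares reach degree \<open>2 * d\<close>.\<close>

definition sos :: "nat \<Rightarrow> bipoly set" where
  "sos d = {(\<Sum>q\<leftarrow>qs. q\<^sup>2) | qs. set qs \<subseteq> bipolys_upto d}"

definition QM :: "bipoly list \<Rightarrow> nat \<Rightarrow> bipoly set" where
  "QM ps d = {\<sigma> 0 + (\<Sum>i<length ps. \<sigma> (Suc i) * ps ! i) | \<sigma>. \<forall>i\<le>length ps. \<sigma> i \<in> sos d}"

definition Lasserre :: "bipoly list \<Rightarrow> nat \<Rightarrow> (real \<times> real) set" where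
  "Lasserre ps d = {z. \<forall>l \<in> QM ps d \<inter> bipolys_upto 1. eval2 l z \<ge> 0}"

lemma eval2_simps [simp]:
  "eval2 polyX z = fst z" "eval2 polyY z = snd z"
  "eval2 0 z = 0" "eval2 1 z = 1"
  "eval2 (p + q) z = eval2 p z + eval2 q z"
  "eval2 (p - q) z = eval2 p z - eval2 q z"
  "eval2 (p * q) z = eval2 p z * eval2 q z"
  "eval2 (p ^ n) z = eval2 p z ^ n"
  by (simp_all add: eval2_def polyX_def polyY_def)

lemma coeff_monomial:
  "coeff (coeff (smult [:c:] (polyX ^ a * polyY ^ b)) j) i = (if i = a \<and> j = b then c else 0)"
proof -
  have X: "polyX = monom (monom 1 1) 0" and Y: "polyY = monom 1 1"
    by (simp_all add: polyX_def polyY_def monom_altdef)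
  show ?thesis
    unfolding X Y by (simp add: monom_power mult_monom smult_monom)
qed

text \<open>
  The library's \<open>T exposed_face_of S\<close> writes the supporting affine polynomial as
  \<open>\<ell>(x) = b - a \<bullet> x\<close>; \<open>a = 0\<close> is allowed, as are constant \<open>\<ell>\<close> in the usual definition.
  The library's notions also admit the empty set as a face, which makes no difference
  for a singleton.
\<close>

end

theory Submission
  imports Defs
begin

text \<open>
  For \<open>t \<ge> 1/2\<close> the tangent \<open>Y - 3t\<^sup>2X + 2t\<^sup>3\<close> to the cubic at \<open>(t, t\<^sup>3)\<close> lies in the quadratic
  module, because it equals \<open>(2t - 1)(X - t)\<^sup>2 + (X - t)\<^sup>2(1 + X) + (Y - X\<^sup>3)\<close>. Hence the
  relaxation lies above the cubic for \<open>x \<ge> 1/2\<close> and above its tangent at \<open>1/2\<close>, which makes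
  \<open>(1/2, 1/8)\<close> extreme. A line exposing it would have to be that tangent, but the tangent also
  contains \<open>(1/3, 0)\<close>, which lies in the relaxation: restricting a linear element of the quadratic
  module to \<open>Y = 0\<close> forces the multiplier of \<open>Y - X\<^sup>3\<close> to restrict to a constant, and
  \<open>f \<mapsto> (8 f(1/2) + f(-1)) / 9\<close> annihilates \<open>X\<^sup>3\<close>, sends \<open>X\<close> to \<open>1/3\<close> and is nonnegative on the
  remaining summands.
\<close>

lemma eval2_sos_nonneg:
  assumes "\<sigma> \<in> sos d"
  shows "eval2 \<sigma> z \<ge> 0"
proof -
  have "eval2 (\<Sum>q\<leftarrow>qs. q\<^sup>2) z \<ge> 0" for qs
    by (induction qs) auto
  with assms show ?thesis
    unfolding sos_def by blast
qed

lemma bipolys_upto_zero_one: "0 \<in> bipolys_upto d" "1 \<in> bipolys_upto d"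
  by (auto simp: bipolys_upto_def coeff_1)

lemma square_in_sos: "q \<in> bipolys_upto d \<Longrightarrow> q\<^sup>2 \<in> sos d"
  unfolding sos_def by (intro CollectI exI[of _ "[q]"]) auto

lemma zero_in_sos: "0 \<in> sos d"
  using square_in_sos[OF bipolys_upto_zero_one(1)] by simp

lemma one_in_sos: "1 \<in> sos d"
  using square_in_sos[OF bipolys_upto_zero_one(2)] by simp

lemma eval2_sum: "eval2 (\<Sum>i\<in>A. f i) z = (\<Sum>i\<in>A. eval2 (f i) z)"
  by (induction A rule: infinite_finite_induct) auto

text \<open>Sums of squares are nonnegative everywhere, so all of \<open>QM ps d\<close> is
  nonnegative wherever the constraints are.\<close>

lemma feasible_in_Lasserre:
  assumes "\<And>p. p \<in> set ps \<Longrightarrow> eval2 p z \<ge> 0"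
  shows "z \<in> Lasserre ps d"
proof -
  have "eval2 l z \<ge> 0" if "l \<in> QM ps d" for l
  proof -
    from that obtain \<sigma> where \<sigma>: "\<forall>i\<le>length ps. \<sigma> i \<in> sos d"
      and l: "l = \<sigma> 0 + (\<Sum>i<length ps. \<sigma> (Suc i) * ps ! i)"
      unfolding QM_def by blast
    have "eval2 (\<sigma> i) z \<ge> 0" if "i \<le> length ps" for i
      using \<sigma> that eval2_sos_nonneg by blast
    with assms show ?thesis
      by (auto simp: l eval2_sum intro!: add_nonneg_nonneg sum_nonneg mult_nonneg_nonneg)
  qed
  then show ?thesis by (auto simp: Lasserre_def)
qed

lemma bipoly_upto_1_iff:
  "p \<in> bipolys_upto 1 \<longleftrightarrow> (\<exists>a b c. p = [:[:a, b:], [:c:]:])"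
proof
  assume p: "p \<in> bipolys_upto 1"
  have *: "coeff (coeff p j) i = 0" if "i + j > 1" for i j
    using p that by (force simp: bipolys_upto_def)
  have "p = [:[:coeff (coeff p 0) 0, coeff (coeff p 0) 1:], [:coeff (coeff p 1) 0:]:]"
    by (intro poly_eqI) (auto simp: coeff_pCons * split: nat.splits)
  then show "\<exists>a b c. p = [:[:a, b:], [:c:]:]" by blast
next
  show "\<exists>a b c. p = [:[:a, b:], [:c:]:] \<Longrightarrow> p \<in> bipolys_upto 1"
    by (auto simp: bipolys_upto_def coeff_pCons split: nat.splits)
qed

lemma eval2_Y_0: "eval2 p (x, 0) = poly (coeff p 0) x"
  by (simp add: eval2_def poly_0_coeff_0)

text \<open>\<open>coeff \<sigma> 0\<close> is the restriction to \<open>Y = 0\<close>, and squares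
  of affine polynomials restrict to quadratics in \<open>X\<close>. This bound allows certificates
  to be compared coefficient by coefficient.\<close>

lemma sos_1_coeff_0:
  assumes "\<sigma> \<in> sos 1"
  obtains a b c where "coeff \<sigma> 0 = [:c, b, a:]"
proof -
  have "\<exists>a b c. coeff (\<Sum>q\<leftarrow>qs. q\<^sup>2) 0 = [:c, b, a:]" if "set qs \<subseteq> bipolys_upto 1" for qs
    using that
  proof (induction qs)
    case Nil
    show ?case by (rule exI[of _ 0])+ simp
  next
    case (Cons q qs)
    then obtain a b c where "coeff (\<Sum>q\<leftarrow>qs. q\<^sup>2) 0 = [:c, b, a:]" by auto
    moreover from Cons.prems have "q \<in> bipolys_upto 1" by simp
    then obtain u v w where "q = [:[:u, v:], [:w:]:]" using bipoly_upto_1_iff by blast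
    ultimately have "coeff (\<Sum>q\<leftarrow>q # qs. q\<^sup>2) 0 = [:c + u * u, b + 2 * u * v, a + v * v:]"
      by (simp add: power2_eq_square)
    then show ?case by blast
  qed
  with assms that show thesis
    unfolding sos_def by blast
qed

definition cubic_constraints :: "bipoly list" where
  "cubic_constraints = [polyY, 1 - polyY, 1 + polyX, polyY - polyX ^ 3]"

lemma cubic_QM_D:
  assumes "l \<in> QM cubic_constraints d"
  obtains s0 s1 s2 s3 s4
  where "s0 \<in> sos d" "s1 \<in> sos d" "s2 \<in> sos d" "s3 \<in> sos d" "s4 \<in> sos d"
    "l = s0 + s1 * polyY + s2 * (1 - polyY) + s3 * (1 + polyX) + s4 * (polyY - polyX ^ 3)"
proof -
  from assms obtain \<sigma> where \<sigma>: "\<forall>i\<le>length cubic_constraints. \<sigma> i \<in> sos d"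
    and l: "l = \<sigma> 0 + (\<Sum>i<length cubic_constraints. \<sigma> (Suc i) * cubic_constraints ! i)"
    unfolding QM_def by blast
  show thesis
    by (rule that[of "\<sigma> 0" "\<sigma> 1" "\<sigma> 2" "\<sigma> 3" "\<sigma> 4"])
      (use \<sigma> l in \<open>simp_all add: cubic_constraints_def eval_nat_numeral\<close>)
qed

lemma cubic_tangent_in_QM:
  fixes t :: real
  assumes "t \<ge> 1/2"
  shows "[:[:2 * t ^ 3, - 3 * t\<^sup>2:], [:1:]:] \<in> QM cubic_constraints 1"
proof -
  \<comment> \<open>The factor \<open>2 * t - 1\<close> is absorbed into the square of
    \<open>q'\<close>; its real root is where \<open>t \<ge> 1/2\<close> enters.\<close>
  define r where "r = sqrt (2 * t - 1)"
  have r: "r * r = 2 * t - 1" using assms by (simp add: r_def)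
  define q where "q = ([:[:- t, 1:], [:0:]:] :: bipoly)"
  define q' where "q' = smult [:r:] q"
  have "q' = [:[:- (r * t), r:], [:0:]:]" by (simp add: q_def q'_def)
  then have "q \<in> bipolys_upto 1" "q' \<in> bipolys_upto 1"
    unfolding bipoly_upto_1_iff q_def by blast+
  then have *: "q\<^sup>2 \<in> sos 1" "q'\<^sup>2 \<in> sos 1" by (auto intro: square_in_sos)
  have "q'\<^sup>2 = smult [:2 * t - 1:] (q\<^sup>2)"
    by (simp add: q'_def power2_eq_square r)
  then have eq: "[:[:2 * t ^ 3, - 3 * t\<^sup>2:], [:1:]:]
    = q'\<^sup>2 + (q\<^sup>2 * (1 + polyX) + (polyY - polyX ^ 3))"
    by (simp add: q_def polyX_def polyY_def power2_eq_square power3_eq_cube algebra_simps one_pCons)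
  show ?thesis
    unfolding QM_def eq
    \<comment> \<open>Multipliers are shifted by one against the constraints: 3 belongs to
      \<open>1 + polyX\<close>, 4 to \<open>polyY - polyX ^ 3\<close>.\<close>
    by (intro CollectI exI[of _ "\<lambda>i. if i = 0 then q'\<^sup>2 else if i = 3 then q\<^sup>2 else if i = 4 then 1 else 0"])
      (use * in \<open>simp add: zero_in_sos one_in_sos cubic_constraints_def eval_nat_numeral\<close>)
qed

lemma Lasserre_cubic_above_tangent:
  assumes "(x, y) \<in> Lasserre cubic_constraints 1" and "t \<ge> 1/2"
  shows "y - 3 * t\<^sup>2 * x + 2 * t ^ 3 \<ge> 0"
proof -
  have "[:[:2 * t ^ 3, - 3 * t\<^sup>2:], [:1:]:] \<in> QM cubic_constraints 1 \<inter> bipolys_upto 1"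
    using cubic_tangent_in_QM[OF assms(2)] bipoly_upto_1_iff by blast
  with assms(1) have "eval2 [:[:2 * t ^ 3, - 3 * t\<^sup>2:], [:1:]:] (x, y) \<ge> 0"
    unfolding Lasserre_def by blast
  then show ?thesis by (simp add: eval2_def algebra_simps)
qed

text \<open>The point violates \<open>Y - X^3 \<ge> 0\<close>, so feasibility does not give
  membership; every affine element of the quadratic module has to be examined.\<close>

lemma third_zero_in_Lasserre_cubic: "(1/3, 0) \<in> Lasserre cubic_constraints 1"
proof -
  have "eval2 l (1/3, 0) \<ge> 0" if l: "l \<in> QM cubic_constraints 1" "l \<in> bipolys_upto 1" for l
  proof -
    from l(1) obtain s0 s1 s2 s3 s4 where s: "s0 \<in> sos 1" "s1 \<in> sos 1" "s2 \<in> sos 1" "s3 \<in> sos 1" "s4 \<in> sos 1"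
      and l_eq: "l = s0 + s1 * polyY + s2 * (1 - polyY) + s3 * (1 + polyX) + s4 * (polyY - polyX ^ 3)"
      by (rule cubic_QM_D)
    obtain \<alpha> \<beta> \<gamma> where l_aff: "l = [:[:\<alpha>, \<beta>:], [:\<gamma>:]:]" using l(2) bipoly_upto_1_iff by blast
    obtain a0 b0 c0 where s0: "coeff s0 0 = [:c0, b0, a0:]" using s(1) by (rule sos_1_coeff_0)
    obtain a2 b2 c2 where s2: "coeff s2 0 = [:c2, b2, a2:]" using s(3) by (rule sos_1_coeff_0)
    obtain a3 b3 c3 where s3: "coeff s3 0 = [:c3, b3, a3:]" using s(4) by (rule sos_1_coeff_0)
    obtain a b c where s4: "coeff s4 0 = [:c, b, a:]" using s(5) by (rule sos_1_coeff_0)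
    have "[:\<alpha>, \<beta>:] = coeff l 0" using l_aff by simp
    also have "\<dots> = [:c0, b0, a0:] + [:c2, b2, a2:] + [:c3, b3, a3:] * [:1, 1:] - [:c, b, a:] * [:0, 0, 0, 1:]"
      unfolding l_eq by (simp add: coeff_mult polyX_def polyY_def power3_eq_cube s0 s2 s3 s4 one_pCons)
    \<comment> \<open>Coefficients of \<open>X^1\<close>, \<open>X^0\<close>, \<open>X^2\<close>,
      \<open>X^3\<close>, \<open>X^4\<close>, \<open>X^5\<close> in turn; the last two make the
      multiplier of \<open>Y - X^3\<close> constant on \<open>Y = 0\<close>.\<close>
    finally have *: "\<beta> = b0 + b2 + b3 + c3" "\<alpha> = c0 + c2 + c3"
        "a0 + a2 + a3 + b3 = 0" "a3 = c" "b = 0" "a = 0"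
      by (simp_all add: algebra_simps)
    have nonneg: "eval2 s0 (1/2, 0) \<ge> 0" "eval2 s2 (1/2, 0) \<ge> 0" "eval2 s3 (1/2, 0) \<ge> 0"
         "eval2 s0 (-1, 0) \<ge> 0" "eval2 s2 (-1, 0) \<ge> 0"
      using s by (auto intro: eval2_sos_nonneg)
    \<comment> \<open>The functional is applied to both sides: \<open>1 + X\<close> is
      \<open>3/2\<close> at \<open>1/2\<close> and vanishes at \<open>-1\<close>, so
      \<open>s3\<close> contributes only at \<open>1/2\<close>.\<close>
    have "\<alpha> + \<beta> / 3 = 8/9 * (eval2 s0 (1/2, 0) + eval2 s2 (1/2, 0) + 3/2 * eval2 s3 (1/2, 0))
        + 1/9 * (eval2 s0 (-1, 0) + eval2 s2 (-1, 0))"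
      using * by (simp add: eval2_Y_0 s0 s2 s3 field_simps)
    with nonneg have "\<alpha> + \<beta> / 3 \<ge> 0" by simp
    then show ?thesis by (simp add: eval2_Y_0 l_aff)
  qed
  then show ?thesis by (auto simp: Lasserre_def)
qed

lemma cubic_point_in_Lasserre_cubic:
  assumes "0 \<le> x" "x \<le> 1"
  shows "(x, x ^ 3) \<in> Lasserre cubic_constraints d"
  using assms by (intro feasible_in_Lasserre) (auto simp: cubic_constraints_def power_le_one)

text \<open>To the right of \<open>1/2\<close> the tangent at \<open>1/2\<close> runs strictly below
  the cubic, while the relaxation stays above it.\<close>

lemma Lasserre_cubic_tangent_right:
  assumes "(x, y) \<in> Lasserre cubic_constraints 1" and "y = 3/4 * x - 1/4"
  shows "x \<le> 1/2"
proof (rule ccontr)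
  assume "\<not> x \<le> 1/2"
  then have x: "x > 1/2" by simp
  \<comment> \<open>The tangent touching the cubic at abscissa \<open>x\<close> itself gives the
    cubic bound.\<close>
  with Lasserre_cubic_above_tangent[OF assms(1), of x] have "y - x ^ 3 \<ge> 0"
    by (simp add: power2_eq_square power3_eq_cube)
  moreover have "y - x ^ 3 = - ((x - 1/2)\<^sup>2 * (x + 1))"
    unfolding assms(2) by (simp add: power2_eq_square power3_eq_cube field_simps)
  moreover have "(x - 1/2)\<^sup>2 * (x + 1) > 0" using x by (intro mult_pos_pos) auto
  ultimately show False by linarith
qed

lemma half_extreme_point_of_Lasserre_cubic:
  "(1/2, 1/8) extreme_point_of Lasserre cubic_constraints 1"
  unfolding extreme_point_of_def
proof (intro conjI ballI notI)
  show "(1/2, 1/8) \<in> Lasserre cubic_constraints 1"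
    using cubic_point_in_Lasserre_cubic[of "1/2" 1] by (simp add: power3_eq_cube)
next
  fix a b :: "real \<times> real"
  assume S: "a \<in> Lasserre cubic_constraints 1" "b \<in> Lasserre cubic_constraints 1"
    and seg: "(1/2, 1/8) \<in> open_segment a b"
  obtain a1 a2 b1 b2 where ab: "a = (a1, a2)" "b = (b1, b2)" by fastforce
  from seg obtain u where u: "0 < u" "u < 1" and ne: "a \<noteq> b"
    and z: "1/2 = (1 - u) * a1 + u * b1" "1/8 = (1 - u) * a2 + u * b2"
    by (auto simp: in_segment ab)
  \<comment> \<open>\<open>f\<close> and \<open>g\<close> are the values at \<open>a\<close> and
    \<open>b\<close> of the tangent polynomial at \<open>1/2\<close>. They are nonnegative with
    weighted mean 0, so both endpoints lie on the tangent.\<close>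
  define f where "f = a2 - 3/4 * a1 + 1/4"
  define g where "g = b2 - 3/4 * b1 + 1/4"
  have fg: "f \<ge> 0" "g \<ge> 0"
    using Lasserre_cubic_above_tangent[of _ _ "1/2"] S
    by (fastforce simp: ab f_def g_def power2_eq_square power3_eq_cube)+
  have "(1 - u) * f + u * g
      = ((1 - u) * a2 + u * b2) - 3/4 * ((1 - u) * a1 + u * b1) + 1/4"
    by (simp add: f_def g_def field_simps)
  also have "\<dots> = 0" unfolding z[symmetric] by simp
  finally have "(1 - u) * f + u * g = 0" .
  with fg u have "(1 - u) * f = 0" "u * g = 0"
    by (simp_all add: add_nonneg_eq_0_iff)
  with u have tangent: "a2 = 3/4 * a1 - 1/4" "b2 = 3/4 * b1 - 1/4"
    by (auto simp: f_def g_def)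
  \<comment> \<open>On the tangent both abscissas are at most \<open>1/2\<close>, and their weighted
    mean is \<open>1/2\<close>; so the endpoints coincide.\<close>
  with S ab have "1/2 - a1 \<ge> 0" "1/2 - b1 \<ge> 0"
    using Lasserre_cubic_tangent_right by fastforce+
  moreover have "(1 - u) * (1/2 - a1) + u * (1/2 - b1) = 0"
  proof -
    have "(1 - u) * (1/2 - a1) + u * (1/2 - b1) = 1/2 - ((1 - u) * a1 + u * b1)"
      by (simp add: field_simps)
    then show ?thesis using z(1) by linarith
  qed
  ultimately have "(1 - u) * (1/2 - a1) = 0" "u * (1/2 - b1) = 0"
    using u by (simp_all add: add_nonneg_eq_0_iff)
  with u ne tangent show False by (auto simp: ab)
qed

lemma half_not_exposed_in_Lasserre_cubic:
  "\<not> {(1/2, 1/8)} exposed_face_of Lasserre cubic_constraints 1"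
proof
  assume "{(1/2, 1/8)} exposed_face_of Lasserre cubic_constraints 1"
  then obtain v \<beta> where le: "Lasserre cubic_constraints 1 \<subseteq> {z. v \<bullet> z \<le> \<beta>}"
    and eq: "{(1/2, 1/8)} = Lasserre cubic_constraints 1 \<inter> {z. v \<bullet> z = \<beta>}"
    unfolding exposed_face_of_def by blast
  obtain p q where v: "v = (p, q)" by fastforce
  have "(1/2, 1/8) \<in> {z. v \<bullet> z = \<beta>}" using eq by blast
  then have \<beta>: "\<beta> = p / 2 + q / 8" by (simp add: v)
  have "v \<bullet> (1/3, 0) \<le> \<beta>"
    using third_zero_in_Lasserre_cubic le by blast
  moreover have "(1/3, 0) \<notin> {(1/2, 1/8) :: real \<times> real}" by simp
  then have "v \<bullet> (1/3, 0) \<noteq> \<beta>"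
    unfolding eq using third_zero_in_Lasserre_cubic by blast
  \<comment> \<open>The step from \<open>(1/3, 0)\<close> to \<open>(1/2, 1/8)\<close> is
    \<open>1/6\<close> times the tangent direction \<open>(1, 3/4)\<close>, and \<open>v\<close>
    strictly increases along it.\<close>
  ultimately have pos: "p + 3/4 * q > 0" by (simp add: v \<beta>)
  \<comment> \<open>The bound is tested on the cubic just right of \<open>1/2\<close>, with
    \<open>h < 1/2\<close> keeping the abscissa below 1. The bracket is the difference quotient of
    the cubic, whose limit \<open>3/4\<close> contradicts \<open>pos\<close>.\<close>
  have "p + q * (3/4 + 3/2 * h + h\<^sup>2) \<le> 0" if h: "0 < h" "h < 1/2" for h
  proof -
    have "v \<bullet> (1/2 + h, (1/2 + h) ^ 3) \<le> \<beta>"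
      using cubic_point_in_Lasserre_cubic[of "1/2 + h" 1] h le by force
    then have "h * (p + q * (3/4 + 3/2 * h + h\<^sup>2)) \<le> 0"
      by (simp add: v \<beta> power2_eq_square power3_eq_cube algebra_simps)
    with h show ?thesis by (simp add: mult_le_0_iff)
  qed
  then have ev: "\<forall>\<^sub>F h in at_right 0. p + q * (3/4 + 3/2 * h + h\<^sup>2) \<le> 0"
    by (auto simp: eventually_at_right_field intro!: exI[of _ "1/2"])
  have lim: "((\<lambda>h. p + q * (3/4 + 3/2 * h + h\<^sup>2)) \<longlongrightarrow> p + q * (3/4 + 3/2 * 0 + 0\<^sup>2)) (at_right 0)"
    by (intro tendsto_intros)
  have "p + q * (3/4 + 3/2 * 0 + 0\<^sup>2) \<le> 0"
    by (rule tendsto_upperbound[OF lim ev]) simp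
  with pos show False by (simp add: algebra_simps)
qed

theorem corollary4p11:
  fixes S :: "(real \<times> real) set"
  defines "S \<equiv> Lasserre [polyY, 1 - polyY, 1 + polyX, polyY - polyX ^ 3] 1"
  shows "{(1/2, 1/8)} face_of S \<and> \<not> {(1/2, 1/8)} exposed_face_of S"
  using half_extreme_point_of_Lasserre_cubic half_not_exposed_in_Lasserre_cubic
  by (simp add: S_def cubic_constraints_def face_of_singleton)

end
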